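(* Consider a two-armed Bernoulli bandit with means $0<\mu_2<\mu_1<1$ and let $\pi$ be a policy for which there exists a sequence of events $(E_t)_{t\ge 1}$ with $\Pr(\exists t,\ \forall s\ge t:\ E_s)=1$ satisfying: there exists $d>0$ such that for all $i\ge 1$, $$\Pr\left(A_{t+i}\neq 1 \mid H_{t:t+i},\,E_t\right)=O\left(\frac{1}{t^{d}}\right)\quad (t\to\infty),$$ where $H_{t:t+i}:=(A_{t+j},R_{t+j})_{0\le j<i}$ is the truncated history (that is, for each $i$ there are constants $C_i,t_i$ such that for all $t\ge t_i$ and every value $h$ of $H_{t:t+i}$ with $\Pr(H_{t:t+i}=h,E_t)>0$, one has $\Pr(A_{t+i}\ne 1\mid H_{t:t+i}=h,E_t)\le C_i t^{-d}$). Then, for every integer $T\ge 1$, almost surely, $$\mathrm{SliReg}(\pi;T)\le \left\lfloor \frac1d\right\rfloor(\mu_1-\mu_2).$$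
   Context: Two-armed Bernoulli bandit: at each time $t\ge1$ the policy picks an arm $A_t\in\{1,2\}$ (possibly with internal randomization) from the history $(A_1,R_1,\dots,A_{t-1},R_{t-1})$, then observes a reward $R_t\in\{0,1\}$ which, given $A_t$, is Bernoulli with mean $\mu_{A_t}$, independent of the past and of the policy's internal randomness. The sliding regret of a policy $\pi$ is the random variable $\mathrm{SliReg}(\pi;T):=\limsup_{t\to\infty}\left(T\mu_1-\sum_{i=1}^{T}\mu_{A_{t+i}}\right)$, where $\mu_1=\max(\mu_1,\mu_2)$. *)

theory Defs
  imports "HOL-Probability.Probability"
begin

definition history ::
  "(nat \<Rightarrow> 'a \<Rightarrow> nat) \<Rightarrow> (nat \<Rightarrow> 'a \<Rightarrow> nat) \<Rightarrow> nat \<Rightarrow> nat \<Rightarrow> 'a \<Rightarrow> (nat \<times> nat) list"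
  where "history A R s n \<omega> = map (\<lambda>j. (A (s + j) \<omega>, R (s + j) \<omega>)) [0..<n]"

text \<open>
  The variable \<open>U\<close>, with values in an arbitrary measurable space \<open>S\<close>, carries all the internal
  randomness of the policy over all rounds. The arms are \<open>1\<close> and \<open>2\<close>, the policy \<open>\<pi>\<close> maps the
  history \<open>(A\<^sub>1, R\<^sub>1), \<dots>, (A\<^sub>t\<^sub>-\<^sub>1, R\<^sub>t\<^sub>-\<^sub>1)\<close> and this randomness to the arm \<open>A\<^sub>t\<close>, and rounds are
  numbered from \<open>1\<close>; \<open>A 0\<close>, \<open>R 0\<close> and the values of \<open>\<mu>\<close> outside \<open>{1, 2}\<close> are irrelevant.
  The probability space may be larger than what the interaction generates.

  The reward law says that, conditionally on \<open>U\<close>, the past and \<open>A\<^sub>t\<close>, the probability of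
  \<open>R\<^sub>t = 1\<close> is the mean of the arm \<open>A\<^sub>t\<close>: given \<open>A\<^sub>t\<close>, the reward is Bernoulli and independent
  of the past and of the internal randomness.
\<close>

locale two_armed_bernoulli_bandit = prob_space M
  for M :: "'a measure" +
  fixes \<mu> :: "nat \<Rightarrow> real"
    and S :: "'u measure"
    and U :: "'a \<Rightarrow> 'u"
    and \<pi> :: "(nat \<times> nat) list \<Rightarrow> 'u \<Rightarrow> nat"
    and A R :: "nat \<Rightarrow> 'a \<Rightarrow> nat"
  assumes mean_bounds: "\<And>a. a \<in> {1, 2} \<Longrightarrow> 0 \<le> \<mu> a \<and> \<mu> a \<le> 1"
    and seed_measurable: "U \<in> M \<rightarrow>\<^sub>M S"
    and policy_measurable: "\<And>h. \<pi> h \<in> S \<rightarrow>\<^sub>M count_space UNIV"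
    and policy_range: "\<And>h u. u \<in> space S \<Longrightarrow> \<pi> h u \<in> {1, 2}"
    and action: "\<And>t \<omega>. t \<ge> 1 \<Longrightarrow> \<omega> \<in> space M \<Longrightarrow>
      A t \<omega> = \<pi> (history A R 1 (t - 1) \<omega>) (U \<omega>)"
    and reward_measurable: "\<And>t. t \<ge> 1 \<Longrightarrow> R t \<in> M \<rightarrow>\<^sub>M count_space UNIV"
    and reward_range: "\<And>t \<omega>. t \<ge> 1 \<Longrightarrow> \<omega> \<in> space M \<Longrightarrow> R t \<omega> \<in> {0, 1}"
    and reward_law: "\<And>t. t \<ge> 1 \<Longrightarrow>
      (AE \<omega> in M. real_cond_exp M
         (vimage_algebra (space M) (\<lambda>\<omega>. (U \<omega>, history A R 1 (t - 1) \<omega>, A t \<omega>))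
            (S \<Otimes>\<^sub>M count_space UNIV \<Otimes>\<^sub>M count_space UNIV))
         (indicator {\<omega> \<in> space M. R t \<omega> = 1}) \<omega> = \<mu> (A t \<omega>))"

text \<open>Arm \<open>1\<close> is the optimal arm. The limit superior is taken in the extended reals.\<close>

definition sliding_regret ::
  "(nat \<Rightarrow> real) \<Rightarrow> (nat \<Rightarrow> 'a \<Rightarrow> nat) \<Rightarrow> nat \<Rightarrow> 'a \<Rightarrow> ereal"
  where "sliding_regret \<mu> A T \<omega> =
    limsup (\<lambda>t. ereal (real T * \<mu> 1 - (\<Sum>i = 1..T. \<mu> (A (t + i) \<omega>))))"

end

theory Submission
  imports Defs
begin

text \<open>
  Applying the hypothesis successively at the elements of a set \<open>J\<close> of offsets bounds the
  probability of \<open>E\<^sub>t\<close> and suboptimal pulls at all rounds \<open>t + i\<close>, \<open>i \<in> J\<close>, by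
  \<open>O(t powr - (d * card J))\<close>. For \<open>card J = \<lfloor>1 / d\<rfloor> + 1\<close> this is summable in \<open>t\<close>, so by
  Borel--Cantelli almost surely at most \<open>\<lfloor>1 / d\<rfloor>\<close> suboptimal pulls occur in all but finitely many
  windows \<open>t + 1, \<dots>, t + T\<close>.
\<close>

lemma fst_history_nth [simp]: "i < n \<Longrightarrow> fst (history A R s n \<omega> ! i) = A (s + i) \<omega>"
  by (simp add: history_def)

context two_armed_bernoulli_bandit
begin

text \<open>Arms and histories depend on each other, so measurability of the arms is a hypothesis
  here: the induction in \<open>action_measurable\<close> calls this lemma when only the earlier
  arms are known to be measurable.\<close>

lemma history_measurable_if:
  assumes "\<And>j. j < n \<Longrightarrow> A (s + j) \<in> M \<rightarrow>\<^sub>M count_space UNIV"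
    and "\<And>j. j < n \<Longrightarrow> R (s + j) \<in> M \<rightarrow>\<^sub>M count_space UNIV"
  shows "history A R s n \<in> M \<rightarrow>\<^sub>M count_space UNIV"
  using assms
proof (induction n)
  case 0
  then show ?case by (simp add: history_def)
next
  case (Suc n)
  have [measurable]: "history A R s n \<in> M \<rightarrow>\<^sub>M count_space UNIV"
    "A (s + n) \<in> M \<rightarrow>\<^sub>M count_space UNIV" "R (s + n) \<in> M \<rightarrow>\<^sub>M count_space UNIV"
    using Suc by auto
  have "(\<lambda>\<omega>. history A R s n \<omega> @ [(A (s + n) \<omega>, R (s + n) \<omega>)]) \<in> M \<rightarrow>\<^sub>M count_space UNIV"
    by measurable
  then show ?case by (simp add: history_def)
qed

lemma action_measurable: "t \<ge> 1 \<Longrightarrow> A t \<in> M \<rightarrow>\<^sub>M count_space UNIV"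
proof (induction t rule: less_induct)
  case (less t)
  have [measurable]: "history A R 1 (t - 1) \<in> M \<rightarrow>\<^sub>M count_space UNIV"
    using less.IH by (intro history_measurable_if reward_measurable) auto
  note [measurable] = seed_measurable policy_measurable
  \<comment> \<open>The policy is measurable in the seed for each fixed history only. This suffices
    because the random history ranges over a countable type.\<close>
  have "(\<lambda>\<omega>. \<pi> (history A R 1 (t - 1) \<omega>) (U \<omega>)) \<in> M \<rightarrow>\<^sub>M count_space UNIV"
    by (rule measurable_compose_countable'[where I = UNIV and f = "\<lambda>h \<omega>. \<pi> h (U \<omega>)"])
      (simp_all del: One_nat_def)
  then show ?case
    using action[OF less.prems] by (subst measurable_cong) auto
qed

lemma history_measurable: "s \<ge> 1 \<Longrightarrow> history A R s n \<in> M \<rightarrow>\<^sub>M count_space UNIV"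
  by (rule history_measurable_if) (simp_all add: action_measurable reward_measurable)

lemma action_range:
  assumes "t \<ge> 1" "\<omega> \<in> space M"
  shows "A t \<omega> \<in> {1, 2}"
  using action[OF assms] policy_range[OF measurable_space[OF seed_measurable assms(2)]] by simp

text \<open>Law of total probability: the bound for single values of the history is averaged over
  the values in \<open>Q\<close>. This lets conditions on earlier arms, encoded in \<open>Q\<close>,
  be kept while one more suboptimal pull is added.\<close>

lemma prob_history_le:
  assumes t: "t \<ge> 1" and E: "E \<in> sets M" and c: "c \<ge> 0"
    and le: "\<And>h. \<P>(\<omega> in M. history A R t i \<omega> = h \<and> \<omega> \<in> E) > 0 \<Longrightarrow>
      \<P>(\<omega> in M. A (t + i) \<omega> \<noteq> 1 \<bar> history A R t i \<omega> = h \<and> \<omega> \<in> E) \<le> c"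
  shows "\<P>(\<omega> in M. A (t + i) \<omega> \<noteq> 1 \<and> history A R t i \<omega> \<in> Q \<and> \<omega> \<in> E)
    \<le> c * \<P>(\<omega> in M. history A R t i \<omega> \<in> Q \<and> \<omega> \<in> E)"
proof -
  let ?H = "history A R t i"
  \<comment> \<open>Only finitely many histories of length \<open>i\<close> can occur, so the events
    below split into finite disjoint unions.\<close>
  define L where "L = {h. set h \<subseteq> {1, 2} \<times> {0, 1 :: nat} \<and> length h = i} \<inter> Q"
  have fin: "finite L"
    unfolding L_def by (intro finite_Int disjI1 finite_lists_length_eq) auto
  have H: "?H \<omega> \<in> L" if "\<omega> \<in> space M" "?H \<omega> \<in> Q" for \<omega>
  proof -
    have "(A (t + j) \<omega>, R (t + j) \<omega>) \<in> {1, 2} \<times> {0, 1}" for j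
      using action_range[of "t + j" \<omega>] reward_range[of "t + j" \<omega>] t that(1)
      by (intro SigmaI) auto
    then show ?thesis
      using that(2) by (simp add: L_def history_def image_subset_iff del: mem_Sigma_iff insert_iff)
  qed
  note [measurable] = history_measurable[OF t, of i] E
  have [measurable]: "A (t + i) \<in> M \<rightarrow>\<^sub>M count_space UNIV"
    using t by (intro action_measurable) auto
  let ?F = "\<lambda>h. {\<omega> \<in> space M. ?H \<omega> = h \<and> \<omega> \<in> E}"
  let ?G = "\<lambda>h. {\<omega> \<in> space M. A (t + i) \<omega> \<noteq> 1 \<and> ?H \<omega> = h \<and> \<omega> \<in> E}"
  have single: "prob (?G h) \<le> c * prob (?F h)" for h
  proof (cases "prob (?F h) > 0")
    case True
    then show ?thesis
      using le[of h] by (simp add: cond_prob_def field_simps)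
  next
    \<comment> \<open>A history value of probability zero is not covered by \<open>le\<close>, but
      then both sides vanish.\<close>
    case False
    have "prob (?G h) \<le> prob (?F h)"
      by (rule finite_measure_mono) auto
    then show ?thesis
      using False measure_nonneg[of M "?F h"] by simp
  qed
  have "prob {\<omega> \<in> space M. A (t + i) \<omega> \<noteq> 1 \<and> ?H \<omega> \<in> Q \<and> \<omega> \<in> E} = prob (\<Union>h\<in>L. ?G h)"
    using H by (intro arg_cong[where f = prob]) (auto simp: L_def)
  also have "\<dots> = (\<Sum>h\<in>L. prob (?G h))"
    using fin by (intro finite_measure_finite_Union) (auto simp: disjoint_family_on_def)
  also have "\<dots> \<le> (\<Sum>h\<in>L. c * prob (?F h))"
    by (intro sum_mono single)
  also have "\<dots> = c * prob (\<Union>h\<in>L. ?F h)"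
    using fin by (subst finite_measure_finite_Union)
      (auto simp: disjoint_family_on_def sum_distrib_left)
  also have "(\<Union>h\<in>L. ?F h) = {\<omega> \<in> space M. ?H \<omega> \<in> Q \<and> \<omega> \<in> E}"
    using H by (auto simp: L_def)
  finally show ?thesis .
qed

text \<open>Offsets are added in increasing order. When the new maximum \<open>b\<close> is added,
  the pulls at the smaller offsets can be read off the history of length \<open>b\<close>, so the
  hypothesis at \<open>b\<close> contributes one more factor \<open>t powr (- d)\<close>.\<close>

lemma prob_suboptimal_pulls_le:
  fixes E :: "nat \<Rightarrow> 'a set"
  assumes E: "\<And>t. t \<ge> 1 \<Longrightarrow> E t \<in> sets M"
    and bound: "\<forall>i\<ge>1. \<exists>C::real. \<exists>t\<^sub>0\<ge>1. \<forall>t\<ge>t\<^sub>0. \<forall>h.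
           \<P>(\<omega> in M. history A R t i \<omega> = h \<and> \<omega> \<in> E t) > 0 \<longrightarrow>
           \<P>(\<omega> in M. A (t + i) \<omega> \<noteq> 1 \<bar> history A R t i \<omega> = h \<and> \<omega> \<in> E t)
             \<le> C * real t powr (- d)"
    and J: "finite J" "0 \<notin> J"
  shows "\<exists>C. \<forall>\<^sub>F t in sequentially.
    \<P>(\<omega> in M. (\<forall>i\<in>J. A (t + i) \<omega> \<noteq> 1) \<and> \<omega> \<in> E t) \<le> C * real t powr (- d * card J)"
  using J
proof (induction J rule: finite_linorder_max_induct)
  case empty
  have "\<forall>\<^sub>F t in sequentially.
    \<P>(\<omega> in M. (\<forall>i\<in>{}. A (t + i) \<omega> \<noteq> 1) \<and> \<omega> \<in> E t) \<le> 1 * real t powr (- d * card ({} :: nat set))"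
    \<comment> \<open>Since \<open>0 powr 0 = 0\<close>, the trivial bound by 1 has this form only
      for positive \<open>t\<close>.\<close>
    using eventually_gt_at_top[of 0] by eventually_elim simp
  then show ?case by blast
next
  case (insert b J)
  then obtain D where D: "\<forall>\<^sub>F t in sequentially.
      \<P>(\<omega> in M. (\<forall>i\<in>J. A (t + i) \<omega> \<noteq> 1) \<and> \<omega> \<in> E t) \<le> D * real t powr (- d * card J)"
    by auto
  have "b \<ge> 1" using insert.prems by (cases b) auto
  with bound obtain C t\<^sub>0 where C: "\<And>t h. t \<ge> t\<^sub>0 \<Longrightarrow>
      \<P>(\<omega> in M. history A R t b \<omega> = h \<and> \<omega> \<in> E t) > 0 \<Longrightarrow>
      \<P>(\<omega> in M. A (t + b) \<omega> \<noteq> 1 \<bar> history A R t b \<omega> = h \<and> \<omega> \<in> E t) \<le> C * real t powr (- d)"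
    by blast
  have card: "card (insert b J) = Suc (card J)"
    using insert.hyps by (subst card_insert_disjoint) auto
  let ?Q = "{h :: (nat \<times> nat) list. \<forall>i\<in>J. fst (h ! i) \<noteq> 1}"
  have Q: "history A R t b \<omega> \<in> ?Q \<longleftrightarrow> (\<forall>i\<in>J. A (t + i) \<omega> \<noteq> 1)" for t \<omega>
    using insert.hyps by auto
  \<comment> \<open>The given constant \<open>C\<close> may be negative; its absolute value makes
    the factor in front of the induction bound nonnegative.\<close>
  have "\<forall>\<^sub>F t in sequentially. \<P>(\<omega> in M. (\<forall>i\<in>insert b J. A (t + i) \<omega> \<noteq> 1) \<and> \<omega> \<in> E t)
      \<le> (\<bar>C\<bar> * D) * real t powr (- d * card (insert b J))"
    using D eventually_ge_at_top[of "max 1 t\<^sub>0"]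
  proof eventually_elim
    case (elim t)
    have "\<P>(\<omega> in M. A (t + b) \<omega> \<noteq> 1 \<and> history A R t b \<omega> \<in> ?Q \<and> \<omega> \<in> E t)
        \<le> (\<bar>C\<bar> * real t powr (- d)) * \<P>(\<omega> in M. history A R t b \<omega> \<in> ?Q \<and> \<omega> \<in> E t)"
    proof (rule prob_history_le)
      show "\<P>(\<omega> in M. A (t + b) \<omega> \<noteq> 1 \<bar> history A R t b \<omega> = h \<and> \<omega> \<in> E t)
          \<le> \<bar>C\<bar> * real t powr (- d)"
        if "\<P>(\<omega> in M. history A R t b \<omega> = h \<and> \<omega> \<in> E t) > 0" for h
        using elim that by (intro order.trans[OF C] mult_right_mono) auto
    qed (use elim E in auto)
    also have "\<dots> \<le> (\<bar>C\<bar> * real t powr (- d)) * (D * real t powr (- d * card J))"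
      using elim unfolding Q by (intro mult_left_mono) auto
    also have "\<dots> = (\<bar>C\<bar> * D) * real t powr (- d * card (insert b J))"
      by (simp add: card powr_add[symmetric] algebra_simps)
    finally show ?case
      unfolding Q by (simp add: conj_assoc)
  qed
  then show ?case by blast
qed

text \<open>The condition on \<open>card J\<close> is exactly what makes
  \<open>t powr (- d * card J)\<close> summable. The event \<open>E t\<close> stays inside because
  only the intersection with it has a bounded probability.\<close>

lemma AE_eventually_not_all_suboptimal:
  fixes E :: "nat \<Rightarrow> 'a set"
  assumes E: "\<And>t. t \<ge> 1 \<Longrightarrow> E t \<in> sets M"
    and bound: "\<forall>i\<ge>1. \<exists>C::real. \<exists>t\<^sub>0\<ge>1. \<forall>t\<ge>t\<^sub>0. \<forall>h.
           \<P>(\<omega> in M. history A R t i \<omega> = h \<and> \<omega> \<in> E t) > 0 \<longrightarrow>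
           \<P>(\<omega> in M. A (t + i) \<omega> \<noteq> 1 \<bar> history A R t i \<omega> = h \<and> \<omega> \<in> E t)
             \<le> C * real t powr (- d)"
    and J: "finite J" "0 \<notin> J" "d * card J > 1"
  shows "AE \<omega> in M. \<forall>\<^sub>F t in sequentially. \<not> ((\<forall>i\<in>J. A (t + i) \<omega> \<noteq> 1) \<and> \<omega> \<in> E t)"
proof -
  let ?B = "\<lambda>t. {\<omega> \<in> space M. (\<forall>i\<in>J. A (t + i) \<omega> \<noteq> 1) \<and> \<omega> \<in> E t}"
  obtain C where C: "\<forall>\<^sub>F t in sequentially. prob (?B t) \<le> C * real t powr (- d * card J)"
    using prob_suboptimal_pulls_le[OF E bound J(1,2)] by blast
  \<comment> \<open>Nothing is known about measurability of \<open>E 0\<close>, so Borel-Cantelli is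
    applied to the sequence shifted by one and the shift is undone at the end.\<close>
  have B: "?B (Suc t) \<in> sets M" for t
  proof -
    have [measurable]: "E (Suc t) \<in> sets M" "\<And>i. A (Suc t + i) \<in> M \<rightarrow>\<^sub>M count_space UNIV"
      using E action_measurable by auto
    show ?thesis using J(1) by measurable
  qed
  have "summable (\<lambda>t. C * real t powr (- d * card J))"
    using J(3) by (intro summable_mult) (simp add: summable_real_powr_iff)
  then have "summable (\<lambda>t. prob (?B t))"
    by (rule summable_comparison_test_ev[rotated]) (use C in \<open>auto elim: eventually_mono\<close>)
  then have "summable (\<lambda>t. prob (?B (Suc t)))"
    by (subst summable_Suc_iff)
  then have "AE \<omega> in M. \<forall>\<^sub>F t in sequentially. \<omega> \<in> space M - ?B (Suc t)"
    by (intro borel_cantelli_AE1 B) (auto simp: emeasure_eq_measure)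
  then show ?thesis
  proof eventually_elim
    case (elim \<omega>)
    then show ?case
      by (subst eventually_sequentially_Suc[symmetric]) (auto elim: eventually_mono)
  qed
qed

text \<open>On \<open>space M\<close> every arm other than 1 is arm 2, so each such pull costs the
  same gap and bounding the regret of a window becomes counting.\<close>

lemma regret_eq_card:
  assumes "\<omega> \<in> space M"
  shows "real T * \<mu> 1 - (\<Sum>i = 1..T. \<mu> (A (t + i) \<omega>))
    = card {i \<in> {1..T}. A (t + i) \<omega> \<noteq> 1} * (\<mu> 1 - \<mu> 2)"
proof -
  have "real T * \<mu> 1 - (\<Sum>i = 1..T. \<mu> (A (t + i) \<omega>)) = (\<Sum>i = 1..T. \<mu> 1 - \<mu> (A (t + i) \<omega>))"
    by (simp add: sum_subtractf)
  also have "\<dots> = (\<Sum>i = 1..T. if A (t + i) \<omega> \<noteq> 1 then \<mu> 1 - \<mu> 2 else 0)"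
  proof (intro sum.cong refl)
    fix i assume "i \<in> {1..T}"
    then show "\<mu> 1 - \<mu> (A (t + i) \<omega>) = (if A (t + i) \<omega> \<noteq> 1 then \<mu> 1 - \<mu> 2 else 0)"
      using action_range[of "t + i" \<omega>] assms by auto
  qed
  also have "\<dots> = (\<Sum>i | i \<in> {1..T} \<and> A (t + i) \<omega> \<noteq> 1. \<mu> 1 - \<mu> 2)"
    by (intro sum.inter_filter[symmetric]) simp
  finally show ?thesis by simp
qed

end

theorem theorem3:
  fixes M :: "'a measure" and S :: "'u measure" and U :: "'a \<Rightarrow> 'u"
    and \<mu> :: "nat \<Rightarrow> real" and \<pi> :: "(nat \<times> nat) list \<Rightarrow> 'u \<Rightarrow> nat"
    and A R :: "nat \<Rightarrow> 'a \<Rightarrow> nat" and E :: "nat \<Rightarrow> 'a set"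
    and d :: real and T :: nat
  assumes "two_armed_bernoulli_bandit M \<mu> S U \<pi> A R"
    and "0 < \<mu> 2" and "\<mu> 2 < \<mu> 1" and "\<mu> 1 < 1"
    and "\<And>t. t \<ge> 1 \<Longrightarrow> E t \<in> sets M"
    and "\<P>(\<omega> in M. \<exists>t\<ge>1. \<forall>s\<ge>t. \<omega> \<in> E s) = 1"
    and "d > 0"
    and "\<forall>i\<ge>1. \<exists>C::real. \<exists>t\<^sub>0\<ge>1. \<forall>t\<ge>t\<^sub>0. \<forall>h.
           \<P>(\<omega> in M. history A R t i \<omega> = h \<and> \<omega> \<in> E t) > 0 \<longrightarrow>
           \<P>(\<omega> in M. A (t + i) \<omega> \<noteq> 1 \<bar> history A R t i \<omega> = h \<and> \<omega> \<in> E t)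
             \<le> C * real t powr (- d)"
    and "T \<ge> 1"
  shows "AE \<omega> in M. sliding_regret \<mu> A T \<omega> \<le> ereal (real_of_int \<lfloor>1 / d\<rfloor> * (\<mu> 1 - \<mu> 2))"
proof -
  interpret two_armed_bernoulli_bandit M \<mu> S U \<pi> A R by fact
  note E = assms(5) and bound = assms(8)
  \<comment> \<open>\<open>Suc k\<close> is the least number of suboptimal pulls whose joint
    probability bound is summable.\<close>
  define k where "k = nat \<lfloor>1 / d\<rfloor>"
  have k: "real k = real_of_int \<lfloor>1 / d\<rfloor>"
    using \<open>d > 0\<close> by (simp add: k_def)
  have "1 / d < real (Suc k)"
    using k by linarith
  then have dk: "d * real (Suc k) > 1"
    using \<open>d > 0\<close> by (simp add: field_simps)
  have "AE \<omega> in M. \<exists>t\<ge>1. \<forall>s\<ge>t. \<omega> \<in> E s"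
  \<comment> \<open>Passing from probability one to an almost sure statement needs a measurable
    event, hence the form as a countable union of countable intersections.\<close>
  proof (rule prob_Collect_eq_1[THEN iffD1])
    have "(\<Union>t\<in>{1..}. \<Inter>s\<in>{t..}. E s) \<in> events"
      using E by (intro sets.countable_UN'' sets.countable_INT') auto
    also have "(\<Union>t\<in>{1..}. \<Inter>s\<in>{t..}. E s) = {\<omega> \<in> space M. \<exists>t\<ge>1. \<forall>s\<ge>t. \<omega> \<in> E s}"
      using sets.sets_into_space[OF E] by fastforce
    finally show "{\<omega> \<in> space M. \<exists>t\<ge>1. \<forall>s\<ge>t. \<omega> \<in> E s} \<in> events" .
  qed fact
  \<comment> \<open>The window length \<open>T\<close> is fixed, so there are finitely many sets
    \<open>J\<close>: one null set serves them all, and below one threshold in \<open>t\<close> does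
    too.\<close>
  moreover have "AE \<omega> in M. \<forall>J\<in>{J. J \<subseteq> {1..T} \<and> card J = Suc k}.
      \<forall>\<^sub>F t in sequentially. \<not> ((\<forall>i\<in>J. A (t + i) \<omega> \<noteq> 1) \<and> \<omega> \<in> E t)"
    using dk by (intro AE_finite_allI AE_eventually_not_all_suboptimal[OF E bound])
      (auto dest: finite_subset)
  moreover note AE_space
  ultimately show ?thesis
  proof eventually_elim
    case (elim \<omega>)
    have "\<forall>\<^sub>F t in sequentially. \<omega> \<in> E t"
      using elim(1) unfolding eventually_sequentially by blast
    moreover have "\<forall>\<^sub>F t in sequentially. \<forall>J\<in>{J. J \<subseteq> {1..T} \<and> card J = Suc k}.
        \<not> ((\<forall>i\<in>J. A (t + i) \<omega> \<noteq> 1) \<and> \<omega> \<in> E t)"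
      using elim(2) by (subst eventually_ball_finite_distrib) auto
    ultimately have "\<forall>\<^sub>F t in sequentially.
        real T * \<mu> 1 - (\<Sum>i = 1..T. \<mu> (A (t + i) \<omega>)) \<le> k * (\<mu> 1 - \<mu> 2)"
    proof eventually_elim
      case (elim t)
      \<comment> \<open>More than \<open>k\<close> suboptimal offsets would contain a set of exactly
        \<open>Suc k\<close> of them, one of the excluded sets \<open>J\<close>.\<close>
      have "card {i \<in> {1..T}. A (t + i) \<omega> \<noteq> 1} \<le> k"
      proof (rule ccontr)
        assume "\<not> ?thesis"
        then obtain J where "J \<subseteq> {i \<in> {1..T}. A (t + i) \<omega> \<noteq> 1}" "card J = Suc k"
          by (meson not_less_eq_eq obtain_subset_with_card_n)
        with elim show False by blast
      qed
      then show ?case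
        unfolding regret_eq_card[OF \<open>\<omega> \<in> space M\<close>]
        using \<open>\<mu> 2 < \<mu> 1\<close> by (intro mult_right_mono) auto
    qed
    then show ?case
      unfolding sliding_regret_def k[symmetric] by (intro Limsup_bounded) simp
  qed
qed

end
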